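(* Let $0<\theta\leq 1$, let $f,g\in H^1(\mathbb{R})$ and let $\phi,\psi$ be two fractional wavelets. Then for every $a\in\mathbb{R}\setminus\{0\}$, $$\|(L_\phi^\theta f)(\cdot,a)-(L_\psi^\theta g)(\cdot,a)\|_{H^1(\mathbb{R})}\leq |a|^{\frac{1}{2\theta}}\left(\|f\|_{H^1(\mathbb{R})}\left\|\frac{\phi}{\sqrt{C_{\phi,\theta}}}-\frac{\psi}{\sqrt{C_{\psi,\theta}}}\right\|_{L^1(\mathbb{R})}+\|f-g\|_{H^1(\mathbb{R})}\left\|\frac{\psi}{\sqrt{C_{\psi,\theta}}}\right\|_{L^1(\mathbb{R})} \right).$$
   Context: Functions are complex-valued on $\mathbb{R}$. For $0<\theta\leq1$, the fractional Fourier transform is $(\mathfrak{F}_\theta f)(\xi)=\int_{\mathbb{R}}e^{-i(\operatorname{sgn}\xi)|\xi|^{1/\theta}t}f(t)\,dt$. A fractional wavelet (of order $\theta$) is a non-zero function $\psi\in L^1(\mathbb{R})\cap L^2(\mathbb{R})$ with $C_{\psi,\theta}:=\int_{\mathbb{R}}\frac{|(\mathfrak{F}_\theta\psi)(\xi)|^2}{|\xi|}\,d\xi<\infty$. For $a\in\mathbb{R}\setminus\{0\}$, $b\in\mathbb{R}$, put $\psi_{a,b,\theta}(t)=\frac{1}{|a|^{1/(2\theta)}}\psi\left(\frac{t-b}{(\operatorname{sgn} a)|a|^{1/\theta}}\right)$. The continuous fractional wavelet transform (CFrWT) of $f$ is $(W_\psi^\theta f)(b,a)=\int_{\mathbb{R}}f(t)\overline{\psi_{a,b,\theta}(t)}\,dt$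 whenever the integral is well-defined, and its normalized form is $L_\psi^\theta:=\frac{1}{\sqrt{C_{\psi,\theta}}}W_\psi^\theta$. For fixed $a$, $(L_\psi^\theta f)(\cdot,a)$ is regarded as a function of $b$ (defined almost everywhere). Convolution: $(f\star g)(x)=\int_{\mathbb{R}}f(u)g(x-u)\,du$. Hardy space: fix a Schwartz function $\eta$ with $\int_{\mathbb{R}}\eta(x)\,dx\neq0$ and put $\eta_t(x)=\frac1t\eta(\frac xt)$ for $t>0$. Then $H^1(\mathbb{R})=\{f\in L^1(\mathbb{R}):\int_{\mathbb{R}}\sup_{t>0}|(f\star\eta_t)(x)|\,dx<\infty\}$, with norm $\|f\|_{H^1(\mathbb{R})}=\int_{\mathbb{R}}\sup_{t>0}|(f\star\eta_t)(x)|\,dx$ (the same $\eta$ is used throughout). *)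

theory Defs
  imports "HOL-Analysis.Analysis"
begin

text \<open>
  Functions on the real line are represented by representatives of type \<^typ>\<open>real \<Rightarrow> complex\<close>,
  Lebesgue (not necessarily Borel) measurable; all integrals are taken with respect to
  \<^term>\<open>lebesgue\<close>.
\<close>

definition L1_norm :: "(real \<Rightarrow> complex) \<Rightarrow> real" where
  "L1_norm f = (\<integral>t. cmod (f t) \<partial>lebesgue)"

definition frac_fourier :: "real \<Rightarrow> (real \<Rightarrow> complex) \<Rightarrow> real \<Rightarrow> complex" where
  "frac_fourier \<theta> f \<xi> =
     (\<integral>t. exp (- \<i> * complex_of_real (sgn \<xi> * \<bar>\<xi>\<bar> powr (1 / \<theta>) * t)) * f t \<partial>lebesgue)"

definition admissibility_const :: "real \<Rightarrow> (real \<Rightarrow> complex) \<Rightarrow> real" where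
  "admissibility_const \<theta> \<psi> = (\<integral>\<xi>. (cmod (frac_fourier \<theta> \<psi> \<xi>))\<^sup>2 / \<bar>\<xi>\<bar> \<partial>lebesgue)"

text \<open>
  ``Non-zero'' is meant in the sense of \<open>L\<^sup>1\<close>, i.e. not almost everywhere zero. The last
  conjunct states that the admissibility constant is finite.
\<close>

definition frac_wavelet :: "real \<Rightarrow> (real \<Rightarrow> complex) \<Rightarrow> bool" where
  "frac_wavelet \<theta> \<psi> \<longleftrightarrow>
     integrable lebesgue \<psi> \<and>
     integrable lebesgue (\<lambda>t. (cmod (\<psi> t))\<^sup>2) \<and>
     \<not> (AE t in lebesgue. \<psi> t = 0) \<and>
     integrable lebesgue (\<lambda>\<xi>. (cmod (frac_fourier \<theta> \<psi> \<xi>))\<^sup>2 / \<bar>\<xi>\<bar>)"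

definition wavelet_dilate :: "real \<Rightarrow> (real \<Rightarrow> complex) \<Rightarrow> real \<Rightarrow> real \<Rightarrow> real \<Rightarrow> complex" where
  "wavelet_dilate \<theta> \<psi> a b t =
     complex_of_real (1 / \<bar>a\<bar> powr (1 / (2 * \<theta>))) * \<psi> ((t - b) / (sgn a * \<bar>a\<bar> powr (1 / \<theta>)))"

text \<open>
  For \<open>f\<close> and \<open>\<psi>\<close> in \<open>L\<^sup>1\<close> the integral below exists for almost every \<open>b\<close>; on the exceptional
  null set the Bochner integral takes the value 0.
\<close>

definition cfrwt :: "real \<Rightarrow> (real \<Rightarrow> complex) \<Rightarrow> (real \<Rightarrow> complex) \<Rightarrow> real \<Rightarrow> real \<Rightarrow> complex" where
  "cfrwt \<theta> \<psi> f b a = (\<integral>t. f t * cnj (wavelet_dilate \<theta> \<psi> a b t) \<partial>lebesgue)"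

definition normalized_cfrwt ::
    "real \<Rightarrow> (real \<Rightarrow> complex) \<Rightarrow> (real \<Rightarrow> complex) \<Rightarrow> real \<Rightarrow> real \<Rightarrow> complex" where
  "normalized_cfrwt \<theta> \<psi> f b a =
     complex_of_real (1 / sqrt (admissibility_const \<theta> \<psi>)) * cfrwt \<theta> \<psi> f b a"

definition convolution :: "(real \<Rightarrow> complex) \<Rightarrow> (real \<Rightarrow> complex) \<Rightarrow> real \<Rightarrow> complex" where
  "convolution f g x = (\<integral>u. f u * g (x - u) \<partial>lebesgue)"

text \<open>In the following definition, \<open>D n\<close> is the \<open>n\<close>-th derivative of \<open>\<eta>\<close>.\<close>

definition schwartz :: "(real \<Rightarrow> complex) \<Rightarrow> bool" where
  "schwartz \<eta> \<longleftrightarrow>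
     (\<exists>D :: nat \<Rightarrow> real \<Rightarrow> complex.
        D 0 = \<eta> \<and>
        (\<forall>n x. (D n has_vector_derivative D (Suc n) x) (at x)) \<and>
        (\<forall>k n. bounded (range (\<lambda>x. x ^ k *\<^sub>R D n x))))"

definition approx_dilate :: "(real \<Rightarrow> complex) \<Rightarrow> real \<Rightarrow> real \<Rightarrow> complex" where
  "approx_dilate \<eta> t x = complex_of_real (1 / t) * \<eta> (x / t)"

text \<open>The supremum and its integral are taken in the extended reals, as they may be infinite.\<close>

definition maximal_fun :: "(real \<Rightarrow> complex) \<Rightarrow> (real \<Rightarrow> complex) \<Rightarrow> real \<Rightarrow> ennreal" where
  "maximal_fun \<eta> f x = (SUP t\<in>{0<..}. ennreal (cmod (convolution f (approx_dilate \<eta> t) x)))"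

definition H1_space :: "(real \<Rightarrow> complex) \<Rightarrow> (real \<Rightarrow> complex) set" where
  "H1_space \<eta> = {f. integrable lebesgue f \<and> (\<integral>\<^sup>+x. maximal_fun \<eta> f x \<partial>lebesgue) < \<infinity>}"

text \<open>Meaningful only for members of \<^term>\<open>H1_space \<eta>\<close>, where the integral is finite.\<close>

definition H1_norm :: "(real \<Rightarrow> complex) \<Rightarrow> (real \<Rightarrow> complex) \<Rightarrow> real" where
  "H1_norm \<eta> f = enn2real (\<integral>\<^sup>+x. maximal_fun \<eta> f x \<partial>lebesgue)"

end

theory Submission imports Defs begin

text \<open>
  For fixed \<open>a\<close> the transform is a convolution with the integrable kernel
  \<open>x \<mapsto> cnj (\<psi>\<^sub>a (- x))\<close>, so up to a null set the difference of the two transforms is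
  \<open>f \<star> (P - Q) + (f - g) \<star> Q\<close> for the kernels \<open>P\<close>, \<open>Q\<close> of the two wavelets.
  Since \<open>(f \<star> K) \<star> \<eta>\<^sub>t = K \<star> (f \<star> \<eta>\<^sub>t)\<close>, the maximal function of \<open>f \<star> K\<close> is
  at most \<open>\<bar>K\<bar> \<star> M f\<close>, where \<open>M f\<close> is that of \<open>f\<close>, and Tonelli gives
  \<open>\<parallel>f \<star> K\<parallel> \<le> \<parallel>f\<parallel> \<parallel>K\<parallel>\<^sub>1\<close> in \<open>H\<^sup>1\<close>.
  Rescaling turns the \<open>L\<^sup>1\<close> norm of a kernel into \<open>\<bar>a\<bar> powr (1 / (2 * \<theta>))\<close> times that of
  the wavelet. Lebesgue measurable functions are replaced by Borel representatives so that Fubini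
  applies to the product measure.
\<close>

section \<open>Null sets and Borel representatives\<close>

lemma AE_lebesgue_affine:
  fixes P :: "real \<Rightarrow> bool"
  assumes "AE x in lebesgue. P x" "c \<noteq> 0"
  shows "AE x in lebesgue. P (t + c * x)"
proof -
  from assms(1) have "AE x in lborel. P x" by (simp add: AE_completion_iff)
  then obtain N where N: "{x. \<not> P x} \<subseteq> N" "N \<in> null_sets lborel"
    by (auto elim!: AE_E simp: null_sets_def)
  \<comment> \<open>The exceptional set of \<open>P\<close> may fail to be Borel, so the
    substitution is made for the Borel null set \<open>N\<close> that covers it.\<close>
  have "AE x in lborel. t + c * x \<notin> N"
    using N(2) AE_not_in[OF N(2)] assms(2) by (intro AE_borel_affine) (auto simp: null_sets_def)
  then have "AE x in lborel. P (t + c * x)"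
    by (rule AE_mp) (use N(1) in auto)
  then show ?thesis by (rule AE_completion)
qed

lemma integrable_lebesgue_borel_representative:
  fixes f :: "real \<Rightarrow> complex"
  assumes "integrable lebesgue f"
  obtains f' where "integrable lborel f'" "AE x in lebesgue. f x = f' x"
proof -
  have "(\<lambda>x. Re (f x)) \<in> borel_measurable lebesgue" "(\<lambda>x. Im (f x)) \<in> borel_measurable lebesgue"
    using assms by auto
  then obtain r i where [measurable]: "r \<in> borel_measurable lborel" "i \<in> borel_measurable lborel"
    and ri: "AE x in lborel. Re (f x) = r x" "AE x in lborel. Im (f x) = i x"
    by (blast dest: completion_ex_borel_measurable_real)
  define f' where "f' x = Complex (r x) (i x)" for x
  have m: "f' \<in> borel_measurable lborel"
    unfolding f'_def Complex_eq by measurable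
  have eq: "AE x in lebesgue. f x = f' x"
    using ri by (intro AE_completion) (auto simp: f'_def complex_eq_iff)
  have "integrable lebesgue f'"
    by (rule integrable_cong_AE_imp[OF assms _ eq]) (use m in \<open>auto intro: measurable_completion\<close>)
  then have "integrable lborel f'" using m by (simp add: integrable_completion)
  with eq show thesis by (rule that[rotated])
qed

section \<open>Convolution: change of representatives, Fubini, continuity\<close>

lemma lebesgue_measurable_reflect:
  fixes x :: real
  shows "(\<lambda>u. x - u) \<in> lebesgue \<rightarrow>\<^sub>M lebesgue"
  using lebesgue_affine_measurable[of "\<lambda>_. - 1" x] by (simp)

text \<open>The reflection \<open>u \<mapsto> x - u\<close> preserves null sets, so for each fixed
  \<open>x\<close> the two integrands agree almost everywhere. Equality at every \<open>x\<close>,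
  not just at almost every one, is what survives a supremum over uncountably many
  \<open>t\<close>.\<close>

lemma convolution_cong_AE:
  assumes [measurable]: "f \<in> borel_measurable lebesgue" "f' \<in> borel_measurable lebesgue"
    "g \<in> borel_measurable lebesgue" "g' \<in> borel_measurable lebesgue"
    and f: "AE x in lebesgue. f x = f' x" and g: "AE x in lebesgue. g x = g' x"
  shows "convolution f g = convolution f' g'"
proof
  fix x
  note [measurable] = lebesgue_measurable_reflect
  have "AE u in lebesgue. g (x - u) = g' (x - u)"
    using AE_lebesgue_affine[OF g, of "- 1" x] by simp
  with f have "AE u in lebesgue. f u * g (x - u) = f' u * g' (x - u)" by auto
  then show "convolution f g x = convolution f' g' x"
    unfolding convolution_def by (intro integral_cong_AE) measurable
qed

lemma convolution_borel:
  assumes [measurable]: "f \<in> borel_measurable borel" "g \<in> borel_measurable borel"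
  shows "convolution f g x = (\<integral>u. f u * g (x - u) \<partial>lborel)"
  unfolding convolution_def by (rule integral_completion) measurable

text \<open>By translation invariance the inner integral of the norm is \<open>norm (f u)\<close>
  times a constant, which is integrable in \<open>u\<close>.\<close>

lemma integrable_convolution_integrand:
  fixes f g :: "real \<Rightarrow> complex"
  assumes f: "integrable lborel f" and g: "integrable lborel g"
  shows "integrable (lborel \<Otimes>\<^sub>M lborel) (\<lambda>(u, x). f u * g (x - u))"
proof -
  have [measurable]: "f \<in> borel_measurable borel" "g \<in> borel_measurable borel"
    using f g by auto
  have g_shift: "integrable lborel (\<lambda>x. g (x - u))" for u
    using lborel_integrable_real_affine[OF g, of 1 "- u"] by simp
  have "(\<integral>x. norm (g (x - u)) \<partial>lborel) = (\<integral>x. norm (g x) \<partial>lborel)" for u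
    using lborel_integral_real_affine[of 1 "\<lambda>x. norm (g x)" "- u"] by simp
  then show ?thesis
    using f g_shift
    by (intro lborel_pair.Fubini_integrable) (auto simp: norm_mult)
qed

lemma integrable_times_bounded:
  fixes f g :: "'a \<Rightarrow> complex"
  assumes "integrable M f" "g \<in> borel_measurable M" "\<And>x. norm (g x) \<le> B"
  shows "integrable M (\<lambda>x. f x * g x)"
proof (rule Bochner_Integration.integrable_bound)
  show "integrable M (\<lambda>x. B * norm (f x))" using assms by auto
  show "AE x in M. norm (f x * g x) \<le> norm (B * norm (f x))"
    using assms(3) by (intro AE_I2) (metis abs_ge_self mult.commute mult_right_mono norm_ge_zero norm_mult order.trans real_norm_def)
qed (use assms in auto)

text \<open>Fubini, the substitution \<open>u = v + w\<close>, and Fubini again. Since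
  \<open>e\<close> is bounded, both double integrands are integrable whatever \<open>x\<close> is,
  so the identity holds at every point.\<close>

lemma convolution_convolution:
  fixes f K e :: "real \<Rightarrow> complex"
  assumes f: "integrable lborel f" and K: "integrable lborel K"
    and e[measurable]: "e \<in> borel_measurable borel" and B: "\<And>x. norm (e x) \<le> B"
  shows "convolution (convolution f K) e x = (\<integral>w. K w * convolution f e (x - w) \<partial>lborel)"
proof -
  have [measurable]: "f \<in> borel_measurable borel" "K \<in> borel_measurable borel"
    using f K by auto
  have conv_fK: "convolution f K = (\<lambda>x. \<integral>u. f u * K (x - u) \<partial>lborel)"
    by (rule ext) (simp add: convolution_borel)
  have [measurable]: "convolution f K \<in> borel_measurable borel"
    unfolding conv_fK by measurable
  have int1: "integrable (lborel \<Otimes>\<^sub>M lborel) (\<lambda>(v, u). f v * K (u - v) * e (x - u))"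
    using integrable_times_bounded[OF integrable_convolution_integrand[OF f K],
        of "\<lambda>(v, u). e (x - u)" B] B by (simp add: case_prod_beta')
  have "integrable (lborel \<Otimes>\<^sub>M lborel) (\<lambda>(v, w). f v * K w)"
    using f K by (intro lborel_pair.Fubini_integrable) (auto simp: norm_mult)
  then have int2: "integrable (lborel \<Otimes>\<^sub>M lborel) (\<lambda>(v, w). f v * K w * e (x - w - v))"
    using integrable_times_bounded[of "lborel \<Otimes>\<^sub>M lborel" "\<lambda>(v, w). f v * K w" "\<lambda>(v, w). e (x - w - v)" B] B
    by (simp add: case_prod_beta')
  \<comment> \<open>The factor \<open>e (x - u)\<close> moves inside even for those \<open>u\<close>
    where \<open>convolution f K u\<close> diverges: both sides are then 0.\<close>
  have "convolution (convolution f K) e x = (\<integral>u. (\<integral>v. f v * K (u - v) * e (x - u) \<partial>lborel) \<partial>lborel)"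
    by (subst convolution_borel) (simp_all add: conv_fK)
  also have "\<dots> = (\<integral>v. (\<integral>u. f v * K (u - v) * e (x - u) \<partial>lborel) \<partial>lborel)"
    by (rule lborel_pair.Fubini_integral[OF int1])
  also have "\<dots> = (\<integral>v. (\<integral>w. f v * K w * e (x - w - v) \<partial>lborel) \<partial>lborel)"
  proof (rule Bochner_Integration.integral_cong[OF refl])
    fix v
    show "(\<integral>u. f v * K (u - v) * e (x - u) \<partial>lborel) = (\<integral>w. f v * K w * e (x - w - v) \<partial>lborel)"
      by (subst lborel_integral_real_affine[of 1 _ v]) (simp_all add: algebra_simps)
  qed
  also have "\<dots> = (\<integral>w. (\<integral>v. f v * K w * e (x - w - v) \<partial>lborel) \<partial>lborel)"
    by (rule lborel_pair.Fubini_integral[OF int2, symmetric])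
  also have "\<dots> = (\<integral>w. K w * convolution f e (x - w) \<partial>lborel)"
    by (simp add: convolution_borel mult_ac flip: integral_mult_right_zero)
  finally show ?thesis .
qed

text \<open>Dominated convergence along sequences, with majorant \<open>norm (f u) * B\<close>. This
  provides the open superlevel sets that make the maximal function measurable.\<close>

lemma isCont_convolution:
  fixes f e :: "real \<Rightarrow> complex"
  assumes f: "integrable lborel f" and e: "continuous_on UNIV e" and B: "\<And>x. norm (e x) \<le> B"
  shows "isCont (convolution f e) x"
proof -
  have [measurable]: "f \<in> borel_measurable borel" "e \<in> borel_measurable borel"
    using f e by (auto intro: borel_measurable_continuous_onI)
  have "(\<lambda>n. convolution f e (X n)) \<longlonglongrightarrow> convolution f e x" if X: "X \<longlonglongrightarrow> x" for X
  proof -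
    have "(\<lambda>n. \<integral>u. f u * e (X n - u) \<partial>lborel) \<longlonglongrightarrow> (\<integral>u. f u * e (x - u) \<partial>lborel)"
    proof (rule integral_dominated_convergence)
      show "integrable lborel (\<lambda>u. norm (f u) * B)" using f by auto
      show "AE u in lborel. (\<lambda>n. f u * e (X n - u)) \<longlonglongrightarrow> f u * e (x - u)"
        using X e by (intro AE_I2 tendsto_mult tendsto_const isCont_tendsto_compose[of _ e] tendsto_diff)
          (auto simp: continuous_on_eq_continuous_at)
      show "AE u in lborel. norm (f u * e (X n - u)) \<le> norm (f u) * B" for n
        using B by (intro AE_I2) (simp add: norm_mult mult_left_mono)
    qed measurable
    then show ?thesis by (simp add: convolution_borel)
  qed
  then show ?thesis by (simp add: continuous_at_sequentially comp_def)
qed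

section \<open>Dilates of a Schwartz function and basic properties of the maximal function\<close>

lemma schwartz_continuous_bounded:
  assumes "schwartz \<eta>"
  obtains B where "continuous_on UNIV \<eta>" "\<And>x. norm (\<eta> x) \<le> B"
proof -
  obtain D where D: "D 0 = \<eta>" "\<And>n x. (D n has_vector_derivative D (Suc n) x) (at x)"
    "\<And>k n. bounded (range (\<lambda>x. x ^ k *\<^sub>R D n x))"
    using assms unfolding schwartz_def by metis
  have "continuous_on UNIV \<eta>"
    using D(1,2) by (metis continuous_at_imp_continuous_on has_vector_derivative_continuous)
  \<comment> \<open>The Schwartz condition with power 0 and derivative order 0 bounds \<eta>
    itself.\<close>
  moreover have "bounded (range \<eta>)" using D(3)[of 0 0] D(1) by simp
  then obtain B where "\<And>x. norm (\<eta> x) \<le> B" by (auto simp: bounded_iff)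
  ultimately show thesis by (rule that)
qed


lemma approx_dilate_continuous_bounded:
  assumes "schwartz \<eta>" "t > 0"
  obtains B where "continuous_on UNIV (approx_dilate \<eta> t)" "\<And>x. norm (approx_dilate \<eta> t x) \<le> B"
proof -
  obtain B where B: "continuous_on UNIV \<eta>" "\<And>x. norm (\<eta> x) \<le> B"
    using schwartz_continuous_bounded[OF assms(1)] by blast
  have "continuous_on UNIV (approx_dilate \<eta> t)"
    unfolding approx_dilate_def using assms(2)
    by (intro continuous_intros continuous_on_compose2[OF B(1)]) auto
  moreover have "norm (approx_dilate \<eta> t x) \<le> B / t" for x
    using assms(2) B(2)[of "x / t"] by (simp add: approx_dilate_def norm_mult norm_divide divide_right_mono)
  ultimately show thesis by (rule that)
qed

lemma approx_dilate_borel_measurable: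
  assumes "schwartz \<eta>" "t > 0"
  shows "approx_dilate \<eta> t \<in> borel_measurable borel"
  using approx_dilate_continuous_bounded[OF assms] by (metis borel_measurable_continuous_onI)

lemma maximal_fun_cong_AE:
  assumes "schwartz \<eta>" "f \<in> borel_measurable lebesgue" "f' \<in> borel_measurable lebesgue"
    "AE x in lebesgue. f x = f' x"
  shows "maximal_fun \<eta> f = maximal_fun \<eta> f'"
proof -
  have "convolution f (approx_dilate \<eta> t) = convolution f' (approx_dilate \<eta> t)" if "t > 0" for t
    using approx_dilate_borel_measurable[OF assms(1) that] assms
    by (intro convolution_cong_AE) (auto intro: measurable_completion)
  then show ?thesis
    unfolding maximal_fun_def by (intro ext SUP_cong) auto
qed

text \<open>The supremum over uncountably many \<open>t\<close> is measurable because it is lower semicontinuous.\<close>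

lemma borel_measurable_maximal_fun:
  assumes "schwartz \<eta>" "integrable lborel f"
  shows "maximal_fun \<eta> f \<in> borel_measurable borel"
proof (rule borel_measurableI_greater)
  fix c
  have "open {x. c < ennreal (cmod (convolution f (approx_dilate \<eta> t) x))}" if t: "t > 0" for t
  proof (rule open_Collect_less)
    obtain B where "continuous_on UNIV (approx_dilate \<eta> t)" "\<And>x. norm (approx_dilate \<eta> t x) \<le> B"
      using approx_dilate_continuous_bounded[OF assms(1) t] by blast
    then have "\<forall>x. isCont (convolution f (approx_dilate \<eta> t)) x"
      using isCont_convolution[OF assms(2)] by blast
    then have "continuous_on UNIV (convolution f (approx_dilate \<eta> t))"
      by (simp add: continuous_at_imp_continuous_on)
    then show "continuous_on UNIV (\<lambda>x. ennreal (cmod (convolution f (approx_dilate \<eta> t) x)))"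
      by (intro continuous_on_ennreal continuous_on_norm)
  qed (rule continuous_on_const)
  then have "open (\<Union>t\<in>{0<..}. {x. c < ennreal (cmod (convolution f (approx_dilate \<eta> t) x))})"
    by auto
  moreover have "{x \<in> space borel. c < maximal_fun \<eta> f x} =
      (\<Union>t\<in>{0<..}. {x. c < ennreal (cmod (convolution f (approx_dilate \<eta> t) x))})"
    by (auto simp: maximal_fun_def less_SUP_iff)
  ultimately show "{x \<in> space borel. c < maximal_fun \<eta> f x} \<in> sets borel" by simp
qed

lemma maximal_fun_add_le:
  assumes "schwartz \<eta>" "integrable lebesgue f" "integrable lebesgue g"
  shows "maximal_fun \<eta> (\<lambda>x. f x + g x) x \<le> maximal_fun \<eta> f x + maximal_fun \<eta> g x"
  unfolding maximal_fun_def[of _ "\<lambda>x. f x + g x"]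
proof (rule SUP_least)
  fix t :: real assume "t \<in> {0<..}"
  then have t: "t > 0" by simp
  let ?e = "approx_dilate \<eta> t"
  obtain B where B: "\<And>x. norm (?e x) \<le> B"
    using approx_dilate_continuous_bounded[OF assms(1) t] by blast
  note [measurable] = approx_dilate_borel_measurable[OF assms(1) t]
  have "(\<lambda>u. ?e (x - u)) \<in> borel_measurable lebesgue"
    by (intro measurable_completion) measurable
  \<comment> \<open>Boundedness of the dilate makes the convolution integrals converge at every
    \<open>x\<close>; only then does additivity of the integral give additivity of the
    convolution.\<close>
  then have "integrable lebesgue (\<lambda>u. h u * ?e (x - u))" if "integrable lebesgue h" for h
    using that B by (intro integrable_times_bounded)
  then have "convolution (\<lambda>x. f x + g x) ?e x = convolution f ?e x + convolution g ?e x"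
    using assms by (simp add: convolution_def distrib_right)
  then have "ennreal (cmod (convolution (\<lambda>x. f x + g x) ?e x)) \<le>
      ennreal (cmod (convolution f ?e x)) + ennreal (cmod (convolution g ?e x))"
    by (metis ennreal_leI ennreal_plus norm_ge_zero norm_triangle_ineq)
  also have "\<dots> \<le> maximal_fun \<eta> f x + maximal_fun \<eta> g x"
    unfolding maximal_fun_def using t by (intro add_mono SUP_upper) auto
  finally show "ennreal (cmod (convolution (\<lambda>x. f x + g x) ?e x)) \<le> \<dots>" .
qed

lemma maximal_fun_minus: "maximal_fun \<eta> (\<lambda>x. - f x) = maximal_fun \<eta> f"
  by (simp add: maximal_fun_def convolution_def fun_eq_iff)

section \<open>The convolution estimate for the maximal function\<close>

lemma maximal_fun_convolution_le:
  assumes "schwartz \<eta>" "integrable lborel f" "integrable lborel K"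
  shows "maximal_fun \<eta> (convolution f K) x
    \<le> (\<integral>\<^sup>+w. ennreal (cmod (K w)) * maximal_fun \<eta> f (x - w) \<partial>lborel)"
  unfolding maximal_fun_def[of \<eta> "convolution f K"]
proof (rule SUP_least)
  fix t :: real assume "t \<in> {0<..}"
  then have t: "t > 0" by simp
  let ?e = "approx_dilate \<eta> t"
  obtain B where B: "\<And>x. norm (?e x) \<le> B"
    using approx_dilate_continuous_bounded[OF assms(1) t] by blast
  have "ennreal (cmod (convolution (convolution f K) ?e x)) =
      ennreal (cmod (\<integral>w. K w * convolution f ?e (x - w) \<partial>lborel))"
    using convolution_convolution[OF assms(2,3) approx_dilate_borel_measurable[OF assms(1) t] B] by simp
  \<comment> \<open>If the integrand is not integrable, the Bochner integral on the left is 0 and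
    the bound is trivial.\<close>
  also have "\<dots> \<le> (\<integral>\<^sup>+w. ennreal (cmod (K w * convolution f ?e (x - w))) \<partial>lborel)"
    by (cases "integrable lborel (\<lambda>w. K w * convolution f ?e (x - w))")
      (auto intro: integral_norm_bound_ennreal simp: not_integrable_integral_eq)
  also have "\<dots> \<le> (\<integral>\<^sup>+w. ennreal (cmod (K w)) * maximal_fun \<eta> f (x - w) \<partial>lborel)"
    unfolding maximal_fun_def norm_mult using t
    by (intro nn_integral_mono) (auto simp: ennreal_mult intro!: mult_left_mono SUP_upper)
  finally show "ennreal (cmod (convolution (convolution f K) ?e x)) \<le> \<dots>" .
qed

lemma nn_integral_maximal_fun_convolution_lborel:
  assumes "schwartz \<eta>" "integrable lborel f" "integrable lborel K"
  shows "(\<integral>\<^sup>+x. maximal_fun \<eta> (convolution f K) x \<partial>lborel)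
    \<le> (\<integral>\<^sup>+x. maximal_fun \<eta> f x \<partial>lborel) * (\<integral>\<^sup>+w. ennreal (cmod (K w)) \<partial>lborel)"
proof -
  have [measurable]: "K \<in> borel_measurable borel" "maximal_fun \<eta> f \<in> borel_measurable borel"
    using assms borel_measurable_maximal_fun by auto
  have "(\<integral>\<^sup>+x. maximal_fun \<eta> (convolution f K) x \<partial>lborel) \<le>
      (\<integral>\<^sup>+x. (\<integral>\<^sup>+w. ennreal (cmod (K w)) * maximal_fun \<eta> f (x - w) \<partial>lborel) \<partial>lborel)"
    by (intro nn_integral_mono maximal_fun_convolution_le assms)
  \<comment> \<open>Tonelli requires a jointly measurable integrand; this is where measurability of
    \<open>maximal_fun \<eta> f\<close> enters.\<close>
  also have "\<dots> = (\<integral>\<^sup>+w. (\<integral>\<^sup>+x. ennreal (cmod (K w)) * maximal_fun \<eta> f (x - w) \<partial>lborel) \<partial>lborel)"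
    by (rule lborel_pair.Fubini') measurable
  also have "\<dots> = (\<integral>\<^sup>+w. ennreal (cmod (K w)) * (\<integral>\<^sup>+x. maximal_fun \<eta> f x \<partial>lborel) \<partial>lborel)"
  proof (rule nn_integral_cong)
    fix w
    show "(\<integral>\<^sup>+x. ennreal (cmod (K w)) * maximal_fun \<eta> f (x - w) \<partial>lborel) =
        ennreal (cmod (K w)) * (\<integral>\<^sup>+x. maximal_fun \<eta> f x \<partial>lborel)"
      using nn_integral_real_affine[of "maximal_fun \<eta> f" 1 "- w"] by (simp add: nn_integral_cmult)
  qed
  also have "\<dots> = (\<integral>\<^sup>+x. maximal_fun \<eta> f x \<partial>lborel) * (\<integral>\<^sup>+w. ennreal (cmod (K w)) \<partial>lborel)"
    by (simp add: nn_integral_multc mult.commute)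
  finally show ?thesis .
qed

text \<open>One choice of Borel representatives \<open>f'\<close>, \<open>K'\<close> serves all
  three claims: the convolution does not change at any point, and Fubini for \<open>f'\<close>,
  \<open>K'\<close> gives both its integrability and the almost everywhere convergence of its
  defining integral.\<close>

lemma
  assumes f: "integrable lebesgue f" and K: "integrable lebesgue K"
  shows integrable_convolution: "integrable lebesgue (convolution f K)"
    and AE_integrable_convolution_integrand:
      "AE x in lebesgue. integrable lebesgue (\<lambda>u. f u * K (x - u))"
    and nn_integral_maximal_fun_convolution:
      "schwartz \<eta> \<Longrightarrow> (\<integral>\<^sup>+x. maximal_fun \<eta> (convolution f K) x \<partial>lebesgue)
        \<le> (\<integral>\<^sup>+x. maximal_fun \<eta> f x \<partial>lebesgue) * (\<integral>\<^sup>+w. ennreal (cmod (K w)) \<partial>lebesgue)"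
proof -
  obtain f' where f': "integrable lborel f'" "AE x in lebesgue. f x = f' x"
    using integrable_lebesgue_borel_representative[OF f] by blast
  obtain K' where K': "integrable lborel K'" "AE x in lebesgue. K x = K' x"
    using integrable_lebesgue_borel_representative[OF K] by blast
  have [measurable]: "f' \<in> borel_measurable borel" "K' \<in> borel_measurable borel"
    using f' K' by auto
  have m[measurable]: "f \<in> borel_measurable lebesgue" "K \<in> borel_measurable lebesgue"
      "f' \<in> borel_measurable lebesgue" "K' \<in> borel_measurable lebesgue"
    using f K f' K' by (auto intro: measurable_completion)
  have conv: "convolution f K = convolution f' K'"
    using f' K' m by (intro convolution_cong_AE)
  \<comment> \<open>The variables are swapped so that the sections are taken in \<open>u\<close> for
    fixed \<open>x\<close>.\<close>
  have int: "integrable (lborel \<Otimes>\<^sub>M lborel) (\<lambda>(x, u). f' u * K' (x - u))"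
    using lborel_pair.integrable_product_swap[OF integrable_convolution_integrand[OF f'(1) K'(1)]]
    by simp
  have "convolution f' K' = (\<lambda>x. \<integral>u. f' u * K' (x - u) \<partial>lborel)"
    by (rule ext) (simp add: convolution_borel)
  then have "integrable lborel (convolution f' K')"
    using lborel_pair.integrable_fst'[OF int] by simp
  then show "integrable lebesgue (convolution f K)"
    unfolding conv by (subst integrable_completion) auto
  have "AE x in lebesgue. integrable lborel (\<lambda>u. f' u * K' (x - u))"
    using lborel_pair.AE_integrable_fst'[OF int] by (intro AE_completion) simp
  then show "AE x in lebesgue. integrable lebesgue (\<lambda>u. f u * K (x - u))"
  proof eventually_elim
    case (elim x)
    note [measurable] = lebesgue_measurable_reflect
    have "AE u in lebesgue. K (x - u) = K' (x - u)"
      using AE_lebesgue_affine[OF K'(2), of "- 1" x] by simp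
    with f'(2) have *: "AE u in lebesgue. f' u * K' (x - u) = f u * K (x - u)" by auto
    have "integrable lebesgue (\<lambda>u. f' u * K' (x - u))"
      using elim by (subst integrable_completion) auto
    then show ?case
      by (rule integrable_cong_AE_imp[OF _ _ *]) measurable
  qed
  assume \<eta>: "schwartz \<eta>"
  have "(\<integral>\<^sup>+w. ennreal (cmod (K w)) \<partial>lebesgue) = (\<integral>\<^sup>+w. ennreal (cmod (K' w)) \<partial>lebesgue)"
    using K'(2) by (intro nn_integral_cong_AE) auto
  moreover have "maximal_fun \<eta> f = maximal_fun \<eta> f'"
    using \<eta> m f'(2) by (intro maximal_fun_cong_AE)
  ultimately show "(\<integral>\<^sup>+x. maximal_fun \<eta> (convolution f K) x \<partial>lebesgue)
        \<le> (\<integral>\<^sup>+x. maximal_fun \<eta> f x \<partial>lebesgue) * (\<integral>\<^sup>+w. ennreal (cmod (K w)) \<partial>lebesgue)"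
    using nn_integral_maximal_fun_convolution_lborel[OF \<eta> f'(1) K'(1)]
    by (simp add: conv nn_integral_completion)
qed

section \<open>The wavelet transform as a convolution\<close>

definition wavelet_kernel :: "real \<Rightarrow> real \<Rightarrow> (real \<Rightarrow> complex) \<Rightarrow> real \<Rightarrow> complex" where
  "wavelet_kernel \<theta> a \<psi> x = cnj (wavelet_dilate \<theta> \<psi> a 0 (- x))"

text \<open>At \<open>b - t\<close> the reflected kernel is the conjugate of
  \<open>wavelet_dilate \<theta> \<psi> a b t\<close>. The normalizing constant is real, hence
  passes through the conjugation and can be absorbed into the wavelet.\<close>

lemma normalized_cfrwt_eq_convolution:
  "normalized_cfrwt \<theta> \<psi> f b a =
     convolution f (wavelet_kernel \<theta> a
       (\<lambda>t. \<psi> t / complex_of_real (sqrt (admissibility_const \<theta> \<psi>)))) b"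
  unfolding normalized_cfrwt_def cfrwt_def convolution_def
  by (simp add: wavelet_kernel_def wavelet_dilate_def mult_ac flip: integral_mult_right_zero integral_divide_zero)

text \<open>Rescaling by \<open>s\<close> multiplies the integral of the modulus by
  \<open>\<bar>s\<bar> = c * c\<close>, and the prefactor \<open>1 / c\<close> of the dilate cancels
  one of the two factors.\<close>

lemma
  assumes "a \<noteq> 0" "\<theta> > 0" "integrable lebesgue \<psi>"
  shows integrable_wavelet_kernel: "integrable lebesgue (wavelet_kernel \<theta> a \<psi>)"
    and nn_integral_wavelet_kernel:
      "(\<integral>\<^sup>+x. ennreal (cmod (wavelet_kernel \<theta> a \<psi> x)) \<partial>lebesgue) =
         ennreal (\<bar>a\<bar> powr (1 / (2 * \<theta>)) * L1_norm \<psi>)"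
proof -
  define s where "s = sgn a * \<bar>a\<bar> powr (1 / \<theta>)"
  define c where "c = \<bar>a\<bar> powr (1 / (2 * \<theta>))"
  have s: "s \<noteq> 0" "\<bar>s\<bar> = c * c" and c: "c > 0"
    using assms(1,2) by (auto simp: s_def c_def abs_mult abs_sgn_eq sgn_zero_iff simp flip: powr_add)
  \<comment> \<open>The argument is put in affine form with slope \<open>- 1 / s\<close>, ready for
    the substitution rules; the sign vanishes in the Jacobian.\<close>
  have k: "wavelet_kernel \<theta> a \<psi> x = complex_of_real (1 / c) * cnj (\<psi> (0 + (- 1 / s) * x))" for x
    by (simp add: wavelet_kernel_def wavelet_dilate_def s_def c_def)
  have "integrable lebesgue (\<lambda>x. \<psi> (0 + (- 1 / s) * x))"
    using assms(3) s(1) by (intro lebesgue_integrable_real_affine) auto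
  then show int: "integrable lebesgue (wavelet_kernel \<theta> a \<psi>)"
    unfolding k by simp
  have "L1_norm \<psi> = \<bar>- 1 / s\<bar> *\<^sub>R (\<integral>x. cmod (\<psi> (0 + (- 1 / s) * x)) \<partial>lebesgue)"
    unfolding L1_norm_def using s(1) by (intro lebesgue_integral_real_affine) auto
  then have "(\<integral>x. cmod (wavelet_kernel \<theta> a \<psi> x) \<partial>lebesgue) = c * L1_norm \<psi>"
    using s c by (simp add: k norm_mult norm_divide field_simps)
  then show "(\<integral>\<^sup>+x. ennreal (cmod (wavelet_kernel \<theta> a \<psi> x)) \<partial>lebesgue) =
         ennreal (\<bar>a\<bar> powr (1 / (2 * \<theta>)) * L1_norm \<psi>)"
    using int by (simp add: nn_integral_eq_integral c_def)
qed

section \<open>Hardy space estimates and the theorem\<close>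

lemma nn_integral_maximal_fun_add_le:
  assumes "schwartz \<eta>" "integrable lebesgue f" "integrable lebesgue g"
  shows "(\<integral>\<^sup>+x. maximal_fun \<eta> (\<lambda>x. f x + g x) x \<partial>lebesgue) \<le>
    (\<integral>\<^sup>+x. maximal_fun \<eta> f x \<partial>lebesgue) + (\<integral>\<^sup>+x. maximal_fun \<eta> g x \<partial>lebesgue)"
proof -
  \<comment> \<open>Splitting the integral of a sum needs measurable summands; a Borel
    representative has the same maximal function everywhere.\<close>
  have m: "maximal_fun \<eta> h \<in> borel_measurable lebesgue" if h: "integrable lebesgue h" for h
  proof -
    obtain h' where h': "integrable lborel h'" "AE x in lebesgue. h x = h' x"
      using integrable_lebesgue_borel_representative[OF h] by blast
    have "maximal_fun \<eta> h = maximal_fun \<eta> h'"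
      using assms(1) h h' by (intro maximal_fun_cong_AE) (auto intro: measurable_completion)
    then show ?thesis
      using borel_measurable_maximal_fun[OF assms(1) h'(1)] by (auto intro: measurable_completion)
  qed
  have "(\<integral>\<^sup>+x. maximal_fun \<eta> (\<lambda>x. f x + g x) x \<partial>lebesgue) \<le>
      (\<integral>\<^sup>+x. maximal_fun \<eta> f x + maximal_fun \<eta> g x \<partial>lebesgue)"
    by (intro nn_integral_mono maximal_fun_add_le assms)
  also have "\<dots> = (\<integral>\<^sup>+x. maximal_fun \<eta> f x \<partial>lebesgue) + (\<integral>\<^sup>+x. maximal_fun \<eta> g x \<partial>lebesgue)"
    using assms m by (intro nn_integral_add) auto
  finally show ?thesis .
qed

text \<open>Guarantees that the norm of \<open>f - g\<close> is the true value of its integral and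
  not the value 0 that \<open>enn2real\<close> assigns to infinity.\<close>

lemma H1_space_diff:
  assumes "schwartz \<eta>" "f \<in> H1_space \<eta>" "g \<in> H1_space \<eta>"
  shows "(\<lambda>x. f x - g x) \<in> H1_space \<eta>"
proof -
  have "(\<integral>\<^sup>+x. maximal_fun \<eta> (\<lambda>x. f x + - g x) x \<partial>lebesgue) < \<infinity>"
    using nn_integral_maximal_fun_add_le[OF assms(1), of f "\<lambda>x. - g x"] assms(2,3)
    by (auto simp: H1_space_def maximal_fun_minus elim!: order.strict_trans1)
  then show ?thesis using assms(2,3) by (simp add: H1_space_def)
qed

theorem theorem4p2:
  fixes \<theta> :: real and \<eta> f g \<phi> \<psi> :: "real \<Rightarrow> complex"
  assumes "0 < \<theta>" and "\<theta> \<le> 1"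
    and "schwartz \<eta>" and "(\<integral>x. \<eta> x \<partial>lebesgue) \<noteq> 0"
    and "f \<in> H1_space \<eta>" and "g \<in> H1_space \<eta>"
    and "frac_wavelet \<theta> \<phi>" and "frac_wavelet \<theta> \<psi>"
  shows "\<forall>a::real. a \<noteq> 0 \<longrightarrow>
    (\<lambda>b. normalized_cfrwt \<theta> \<phi> f b a - normalized_cfrwt \<theta> \<psi> g b a) \<in> H1_space \<eta> \<and>
    H1_norm \<eta> (\<lambda>b. normalized_cfrwt \<theta> \<phi> f b a - normalized_cfrwt \<theta> \<psi> g b a)
      \<le> \<bar>a\<bar> powr (1 / (2 * \<theta>)) *
        (H1_norm \<eta> f *
           L1_norm (\<lambda>t. \<phi> t / complex_of_real (sqrt (admissibility_const \<theta> \<phi>))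
                      - \<psi> t / complex_of_real (sqrt (admissibility_const \<theta> \<psi>)))
         + H1_norm \<eta> (\<lambda>t. f t - g t) *
           L1_norm (\<lambda>t. \<psi> t / complex_of_real (sqrt (admissibility_const \<theta> \<psi>))))"
proof (intro allI impI)
  fix a :: real assume a: "a \<noteq> 0"
  define p where "p t = \<phi> t / complex_of_real (sqrt (admissibility_const \<theta> \<phi>))" for t
  define q where "q t = \<psi> t / complex_of_real (sqrt (admissibility_const \<theta> \<psi>))" for t
  define c where "c = \<bar>a\<bar> powr (1 / (2 * \<theta>))"
  define P where "P = wavelet_kernel \<theta> a p"
  define Q where "Q = wavelet_kernel \<theta> a q"
  define h where "h b = normalized_cfrwt \<theta> \<phi> f b a - normalized_cfrwt \<theta> \<psi> g b a" for b
  define D where "D = wavelet_kernel \<theta> a (\<lambda>t. p t - q t)"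
  define h1 where "h1 = convolution f D"
  define h2 where "h2 = convolution (\<lambda>t. f t - g t) Q"
  let ?I = "\<lambda>f. \<integral>\<^sup>+x. maximal_fun \<eta> f x \<partial>lebesgue"
  have f: "integrable lebesgue f" and g: "integrable lebesgue g"
    using assms by (auto simp: H1_space_def)
  have pq: "integrable lebesgue p" "integrable lebesgue q"
    using assms by (auto simp: frac_wavelet_def p_def[abs_def] q_def[abs_def])
  note kernel = integrable_wavelet_kernel[OF a assms(1)] nn_integral_wavelet_kernel[OF a assms(1)]
  have P: "integrable lebesgue P" and Q: "integrable lebesgue Q" and D: "integrable lebesgue D"
    unfolding P_def Q_def D_def using pq by (intro kernel; simp)+
  \<comment> \<open>The kernel is additive in the wavelet; this ties the wavelet difference in the
    bound to the difference of the kernels.\<close>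
  have D_eq: "D x = P x - Q x" for x
    by (simp add: D_def P_def Q_def wavelet_kernel_def wavelet_dilate_def algebra_simps diff_divide_distrib)
  have h: "h = (\<lambda>b. convolution f P b - convolution g Q b)"
    by (simp add: h_def fun_eq_iff normalized_cfrwt_eq_convolution P_def Q_def p_def[abs_def] q_def[abs_def])
  have h_int: "integrable lebesgue h"
    unfolding h using f g P Q by (intro Bochner_Integration.integrable_diff integrable_convolution)
  have h12_int: "integrable lebesgue h1" "integrable lebesgue h2"
    unfolding h1_def h2_def using f g Q D by (auto intro!: integrable_convolution)
  \<comment> \<open>The term \<open>f \<star> Q\<close> is subtracted and added, so its integral
    must converge as well as those of \<open>f \<star> P\<close> and \<open>g \<star> Q\<close>.
    Outside the common set of convergence default values may break the identity, but the maximal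
    function ignores null sets.\<close>
  have "AE b in lebesgue. h b = h1 b + h2 b"
    using AE_integrable_convolution_integrand[OF f P] AE_integrable_convolution_integrand[OF f Q]
      AE_integrable_convolution_integrand[OF g Q]
  proof eventually_elim
    case (elim b)
    then show ?case
      by (simp add: h h1_def h2_def convolution_def D_eq left_diff_distrib right_diff_distrib)
  qed
  then have "maximal_fun \<eta> h = maximal_fun \<eta> (\<lambda>b. h1 b + h2 b)"
    using assms h_int h12_int by (intro maximal_fun_cong_AE) auto
  then have "?I h \<le> ?I h1 + ?I h2"
    using nn_integral_maximal_fun_add_le[OF assms(3) h12_int] by simp
  also have "\<dots> \<le> ?I f * (\<integral>\<^sup>+x. ennreal (cmod (D x)) \<partial>lebesgue)
      + ?I (\<lambda>t. f t - g t) * (\<integral>\<^sup>+x. ennreal (cmod (Q x)) \<partial>lebesgue)"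
    unfolding h1_def h2_def using f g D Q assms
    by (intro add_mono nn_integral_maximal_fun_convolution) auto
  also have "\<dots> = ?I f * ennreal (c * L1_norm (\<lambda>t. p t - q t))
      + ?I (\<lambda>t. f t - g t) * ennreal (c * L1_norm q)"
    using pq by (simp add: D_def Q_def kernel c_def)
  also have "\<dots> = ennreal (c * (H1_norm \<eta> f * L1_norm (\<lambda>t. p t - q t)
      + H1_norm \<eta> (\<lambda>t. f t - g t) * L1_norm q))"
  proof -
    \<comment> \<open>Both integrals on the right are finite, so the bound can be rewritten with
      real norms.\<close>
    have I: "?I u = ennreal (H1_norm \<eta> u)" if "u \<in> H1_space \<eta>" for u
      using that by (auto simp: H1_norm_def H1_space_def)
    have "c \<ge> 0" "L1_norm u \<ge> 0" "H1_norm \<eta> u \<ge> 0" for u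
      by (auto simp: c_def L1_norm_def H1_norm_def)
    then show ?thesis
      using I[OF assms(5)] I[OF H1_space_diff[OF assms(3,5,6)]]
      by (simp add: algebra_simps flip: ennreal_mult ennreal_plus)
  qed
  finally have le: "?I h \<le> \<dots>" .
  \<comment> \<open>The right-hand side is an \<open>ennreal\<close> of a real number, hence finite:
    the same inequality yields membership and the norm bound.\<close>
  then have "h \<in> H1_space \<eta>"
    using h_int by (simp add: H1_space_def order.strict_trans1)
  moreover have "H1_norm \<eta> h \<le> c * (H1_norm \<eta> f * L1_norm (\<lambda>t. p t - q t)
      + H1_norm \<eta> (\<lambda>t. f t - g t) * L1_norm q)"
    using le unfolding H1_norm_def
    by (intro enn2real_leI) (auto simp: c_def L1_norm_def)
  ultimately show "(\<lambda>b. normalized_cfrwt \<theta> \<phi> f b a - normalized_cfrwt \<theta> \<psi> g b a) \<in> H1_space \<eta> \<and>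
    H1_norm \<eta> (\<lambda>b. normalized_cfrwt \<theta> \<phi> f b a - normalized_cfrwt \<theta> \<psi> g b a)
      \<le> \<bar>a\<bar> powr (1 / (2 * \<theta>)) *
        (H1_norm \<eta> f *
           L1_norm (\<lambda>t. \<phi> t / complex_of_real (sqrt (admissibility_const \<theta> \<phi>))
                      - \<psi> t / complex_of_real (sqrt (admissibility_const \<theta> \<psi>)))
         + H1_norm \<eta> (\<lambda>t. f t - g t) *
           L1_norm (\<lambda>t. \<psi> t / complex_of_real (sqrt (admissibility_const \<theta> \<psi>))))"
    unfolding h_def[abs_def] p_def[abs_def] q_def[abs_def] c_def by simp
qed

end
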